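(* Let $X$ be a metric space with metric $d_X$, and let $G$ be a finitely generated group that acts on $X$ by coarse equivalences, with $G$ generated by the finite symmetric set $S$ containing the identity. Then the large scale structure on $X_G$ is induced by the metric defined by $d_{X_G}(x,x)=0$ and, for $x\neq x'$, $$d_{X_G}(x,x')=\inf\Big\{n+\sum_{i=1}^n d_X(a_i,b_i)\ \Big|\ x\in S^2\cdot a_1,\ x'\in S^2\cdot b_n,\ b_i\in S^4\cdot a_{i+1}\ (1\le i<n),\ n\in\mathbb{Z}_+\Big\},$$ where the $a_i,b_i$ range over $X$ and $S^n=\{s_1s_2\cdots s_n\mid s_i\in S \text{ for all } i\}$.
   Context: For families of subsets of $X$, $\mathrm{st}(\mathcal{B},\mathcal{U})=\{\mathrm{st}(B,\mathcal{U})\mid B\in\mathcal{B}\}$, where $\mathrm{st}(B,\mathcal{U})$ is the union of the elements of $\mathcal{U}$ that intersect $B$. A large scale structure on a set $X$ is a nonempty set of families of subsets of $X$ (the uniformly bounded families) such that (1) if $\mathcal{B}_1$ is uniformly bounded and each element of $\mathcal{B}_2$ with more than one point is contained in some element of $\mathcal{B}_1$, then $\mathcal{B}_2$ is uniformly bounded; (2) $\mathrm{st}(\mathcal{B}_1,\mathcal{B}_2)$ is uniformly bounded whenever $\mathcal{B}_1,\mathcal{B}_2$ are. The large scale structure induced by a metric $d$ consists of all families $\mathcal{U}$ with $\sup_{U\in\mathcal{U}}\mathrm{diam}(U)<\infty$. $G$ acts on the metric space $X$ by coarse equivalences if it acts on the underlying set and for every $g\in G$ and $R>0$ there is $T>0$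 such that $d_X(x,y)\le R\Rightarrow d_X(gx,gy)\le T$. $X_G$ is the set $X$ with the smallest large scale structure containing that induced by $d_X$ and all families $\{\{x,gx\}\mid x\in X\}$, $g\in G$. *)

theory Defs
  imports "HOL-Analysis.Analysis" "HOL-Algebra.Group_Action" "HOL-Algebra.Generated_Groups"
begin

section \<open>Large scale structures\<close>

definition star :: "'a set \<Rightarrow> 'a set set \<Rightarrow> 'a set"
  where "star B \<U> = \<Union>{U \<in> \<U>. U \<inter> B \<noteq> {}}"

definition star_family :: "'a set set \<Rightarrow> 'a set set \<Rightarrow> 'a set set"
  where "star_family \<B> \<U> = {star B \<U> | B. B \<in> \<B>}"

definition large_scale_structure :: "'a set \<Rightarrow> 'a set set set \<Rightarrow> bool"
  where "large_scale_structure X L \<longleftrightarrow>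
     L \<noteq> {} \<and> (\<forall>\<B>\<in>L. \<B> \<subseteq> Pow X) \<and>
     (\<forall>\<B>\<^sub>1\<in>L. \<forall>\<B>\<^sub>2. \<B>\<^sub>2 \<subseteq> Pow X \<longrightarrow>
        (\<forall>B\<in>\<B>\<^sub>2. (\<exists>x\<in>B. \<exists>y\<in>B. x \<noteq> y) \<longrightarrow> (\<exists>A\<in>\<B>\<^sub>1. B \<subseteq> A)) \<longrightarrow> \<B>\<^sub>2 \<in> L) \<and>
     (\<forall>\<B>\<^sub>1\<in>L. \<forall>\<B>\<^sub>2\<in>L. star_family \<B>\<^sub>1 \<B>\<^sub>2 \<in> L)"

lemma large_scale_structure_all_families: "large_scale_structure X (Pow (Pow X))"
  unfolding large_scale_structure_def star_family_def star_def by blast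

text \<open>
  The hull \<open>large_scale_structure X hull \<F>\<close> is the intersection of all large scale structures
  on \<open>X\<close> containing \<open>\<F>\<close>. The next lemma, together with \<open>hull_subset\<close> and
  \<open>hull_minimal\<close>, shows that it is the smallest such structure.
\<close>

lemma large_scale_structure_hull:
  assumes "\<F> \<subseteq> Pow (Pow X)"
  shows "large_scale_structure X (large_scale_structure X hull \<F>)"
proof -
  let ?F = "{L. large_scale_structure X L \<and> \<F> \<subseteq> L}"
  have sub: "\<B> \<subseteq> Pow X" if "\<B> \<in> \<Inter>?F" for \<B>
  proof -
    have "Pow (Pow X) \<in> ?F"
      using assms large_scale_structure_all_families[of X] by simp
    with that have "\<B> \<in> Pow (Pow X)"
      by (rule InterD)
    then show ?thesis by simp
  qed
  have refine: "\<B>\<^sub>2 \<in> L"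
    if "L \<in> ?F" "\<B>\<^sub>1 \<in> L" "\<B>\<^sub>2 \<subseteq> Pow X"
      "\<forall>B\<in>\<B>\<^sub>2. (\<exists>x\<in>B. \<exists>y\<in>B. x \<noteq> y) \<longrightarrow> (\<exists>A\<in>\<B>\<^sub>1. B \<subseteq> A)" for L \<B>\<^sub>1 \<B>\<^sub>2
  proof -
    from that(1) have "\<forall>\<B>\<^sub>1\<in>L. \<forall>\<B>\<^sub>2. \<B>\<^sub>2 \<subseteq> Pow X \<longrightarrow>
        (\<forall>B\<in>\<B>\<^sub>2. (\<exists>x\<in>B. \<exists>y\<in>B. x \<noteq> y) \<longrightarrow> (\<exists>A\<in>\<B>\<^sub>1. B \<subseteq> A)) \<longrightarrow> \<B>\<^sub>2 \<in> L"
      unfolding large_scale_structure_def mem_Collect_eq by (elim conjE)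
    from this[THEN bspec, OF that(2), THEN spec, THEN mp, OF that(3), THEN mp, OF that(4)]
    show ?thesis .
  qed
  have empty: "{} \<in> L" if "L \<in> ?F" for L
  proof -
    from that have "L \<noteq> {}"
      unfolding large_scale_structure_def mem_Collect_eq by (elim conjE)
    then obtain \<B> where "\<B> \<in> L" by blast
    then show ?thesis by (rule refine[OF that]) simp_all
  qed
  have star: "star_family \<B>\<^sub>1 \<B>\<^sub>2 \<in> L" if "L \<in> ?F" "\<B>\<^sub>1 \<in> L" "\<B>\<^sub>2 \<in> L" for L \<B>\<^sub>1 \<B>\<^sub>2
  proof -
    from that(1) have "\<forall>\<B>\<^sub>1\<in>L. \<forall>\<B>\<^sub>2\<in>L. star_family \<B>\<^sub>1 \<B>\<^sub>2 \<in> L"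
      unfolding large_scale_structure_def mem_Collect_eq by (elim conjE)
    from this[THEN bspec, OF that(2), THEN bspec, OF that(3)] show ?thesis .
  qed
  show ?thesis
    unfolding hull_def
  proof (subst large_scale_structure_def, intro conjI ballI allI impI)
    have "{} \<in> \<Inter>?F"
      by (rule InterI) (rule empty)
    then show "\<Inter>?F \<noteq> {}" by (metis empty_iff)
  next
    fix \<B> assume "\<B> \<in> \<Inter>?F"
    then show "\<B> \<subseteq> Pow X" by (rule sub)
  next
    fix \<B>\<^sub>1 \<B>\<^sub>2 assume 1: "\<B>\<^sub>1 \<in> \<Inter>?F" and 2: "\<B>\<^sub>2 \<subseteq> Pow X"
      "\<forall>B\<in>\<B>\<^sub>2. (\<exists>x\<in>B. \<exists>y\<in>B. x \<noteq> y) \<longrightarrow> (\<exists>A\<in>\<B>\<^sub>1. B \<subseteq> A)"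
    show "\<B>\<^sub>2 \<in> \<Inter>?F"
      by (rule InterI) (rule refine[OF _ InterD[OF 1] 2], assumption+)
  next
    fix \<B>\<^sub>1 \<B>\<^sub>2 assume 1: "\<B>\<^sub>1 \<in> \<Inter>?F" "\<B>\<^sub>2 \<in> \<Inter>?F"
    show "star_family \<B>\<^sub>1 \<B>\<^sub>2 \<in> \<Inter>?F"
      by (rule InterI) (rule star[OF _ InterD[OF 1(1)] InterD[OF 1(2)]], assumption+)
  qed
qed

text \<open>Diameters are taken in \<^typ>\<open>ennreal\<close>, so that unbounded sets have diameter \<open>\<infinity>\<close> and the
  empty set has diameter \<open>0\<close>.\<close>

definition metric_diam :: "('a \<Rightarrow> 'a \<Rightarrow> real) \<Rightarrow> 'a set \<Rightarrow> ennreal"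
  where "metric_diam d U = (SUP x\<in>U. SUP y\<in>U. ennreal (d x y))"

definition metric_large_scale_structure :: "'a set \<Rightarrow> ('a \<Rightarrow> 'a \<Rightarrow> real) \<Rightarrow> 'a set set set"
  where "metric_large_scale_structure X d =
     {\<U>. \<U> \<subseteq> Pow X \<and> (SUP U\<in>\<U>. metric_diam d U) < \<infinity>}"

lemma metric_large_scale_structure_iff:
  "\<U> \<in> metric_large_scale_structure X d \<longleftrightarrow>
     \<U> \<subseteq> Pow X \<and> (\<exists>C\<ge>0. \<forall>U\<in>\<U>. \<forall>x\<in>U. \<forall>y\<in>U. d x y \<le> C)"
proof -
  have fin: "t < \<infinity> \<longleftrightarrow> (\<exists>C\<ge>0. t \<le> ennreal C)" for t :: ennreal
    by (cases t) (auto simp: top_unique)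
  have le: "(SUP U\<in>\<U>. metric_diam d U) \<le> ennreal C \<longleftrightarrow> (\<forall>U\<in>\<U>. \<forall>x\<in>U. \<forall>y\<in>U. d x y \<le> C)"
    if "0 \<le> C" for C
    using that by (simp add: metric_diam_def SUP_le_iff)
  show ?thesis
    unfolding metric_large_scale_structure_def mem_Collect_eq fin using le by meson
qed


section \<open>Actions by coarse equivalences\<close>

definition coarse_action ::
    "('g, 'm) monoid_scheme \<Rightarrow> 'a set \<Rightarrow> ('a \<Rightarrow> 'a \<Rightarrow> real) \<Rightarrow> ('g \<Rightarrow> 'a \<Rightarrow> 'a) \<Rightarrow> bool"
  where "coarse_action G X d \<phi> \<longleftrightarrow>
     group_action G X \<phi> \<and>
     (\<forall>g\<in>carrier G. \<forall>R>0. \<exists>T>0. \<forall>x\<in>X. \<forall>y\<in>X. d x y \<le> R \<longrightarrow> d (\<phi> g x) (\<phi> g y) \<le> T)"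

definition action_large_scale_structure ::
    "('g, 'm) monoid_scheme \<Rightarrow> 'a set \<Rightarrow> ('a \<Rightarrow> 'a \<Rightarrow> real) \<Rightarrow> ('g \<Rightarrow> 'a \<Rightarrow> 'a) \<Rightarrow> 'a set set set"
  where "action_large_scale_structure G X d \<phi> =
     large_scale_structure X hull
       (metric_large_scale_structure X d \<union> {{{x, \<phi> g x} | x. x \<in> X} | g. g \<in> carrier G})"

definition set_pow :: "('g, 'm) monoid_scheme \<Rightarrow> 'g set \<Rightarrow> nat \<Rightarrow> 'g set"
  where "set_pow G S n =
     {foldr (\<lambda>s t. s \<otimes>\<^bsub>G\<^esub> t) ss \<one>\<^bsub>G\<^esub> | ss. length ss = n \<and> set ss \<subseteq> S}"

text \<open>\<^const>\<open>Metric_space\<close> requires nonnegativity and symmetry for all arguments, not only those in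
  the carrier; the metric is therefore set to \<open>0\<close> off \<open>X \<times> X\<close>.\<close>

definition action_metric ::
    "('g, 'm) monoid_scheme \<Rightarrow> 'a set \<Rightarrow> ('a \<Rightarrow> 'a \<Rightarrow> real) \<Rightarrow> ('g \<Rightarrow> 'a \<Rightarrow> 'a) \<Rightarrow> 'g set \<Rightarrow> 'a \<Rightarrow> 'a \<Rightarrow> real"
  where "action_metric G X d \<phi> S x x' =
     (if x \<notin> X \<or> x' \<notin> X \<or> x = x' then 0
      else Inf {real n + (\<Sum>i=1..n. d (a i) (b i)) | (n::nat) a b.
        n \<ge> 1 \<and> (\<forall>i\<in>{1..n}. a i \<in> X \<and> b i \<in> X) \<and>
        x \<in> (\<lambda>g. \<phi> g (a 1)) ` set_pow G S 2 \<and>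
        x' \<in> (\<lambda>g. \<phi> g (b n)) ` set_pow G S 2 \<and>
        (\<forall>i. 1 \<le> i \<and> i < n \<longrightarrow> b i \<in> (\<lambda>g. \<phi> g (a (i + 1))) ` set_pow G S 4)})"

end

theory Submission
  imports Defs
begin

text \<open>
  A family is bounded for the chain metric precisely when its points are joined by chains with a
  bounded number of links, each of bounded \<open>d\<close>-length. Such chains are compositions of boundedly many
  relations that are controlled in every large scale structure containing the generating families,
  because controlled relations are closed under finite unions and composition. In the other
  direction, one link costs at most \<open>1 + d x y\<close>, and moving a point by a word of length \<open>k\<close> in the
  generators costs at most \<open>k\<close>. Concatenating chains needs \<open>S\<^sup>2 \<cdot> S\<^sup>2 \<subseteq> S\<^sup>4\<close>, whence the exponents.
\<close>

section \<open>Powers of a subset of a group\<close>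

context group
begin

lemma foldr_mult_closed: "set xs \<subseteq> carrier G \<Longrightarrow> foldr (\<otimes>) xs \<one> \<in> carrier G"
  by (induction xs) auto

lemma set_pow_closed:
  assumes "S \<subseteq> carrier G" "g \<in> set_pow G S n"
  shows "g \<in> carrier G"
  using assms foldr_mult_closed unfolding set_pow_def by auto

lemma foldr_mult_append:
  "set xs \<subseteq> carrier G \<Longrightarrow> set ys \<subseteq> carrier G \<Longrightarrow>
    foldr (\<otimes>) (xs @ ys) \<one> = foldr (\<otimes>) xs \<one> \<otimes> foldr (\<otimes>) ys \<one>"
  \<comment> \<open>With \<open>foldr_append\<close> deleted, \<open>xs @ ys\<close> stays intact
    and the induction hypothesis can fire.\<close>
  by (induction xs) (use foldr_mult_closed in \<open>auto simp: m_assoc simp del: foldr_append\<close>)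

lemma inv_foldr_mult:
  "set xs \<subseteq> carrier G \<Longrightarrow>
    inv (foldr (\<otimes>) xs \<one>) = foldr (\<otimes>) (rev (map (m_inv G) xs)) \<one>"
proof (induction xs)
  case (Cons x xs)
  have "set (rev (map (m_inv G) xs)) \<subseteq> carrier G" using Cons.prems by auto
  with Cons show ?case
    using foldr_mult_append[of "rev (map (m_inv G) xs)" "[inv x]"]
    by (simp add: inv_mult_group foldr_mult_closed del: foldr_append)
qed simp

lemma set_pow_mult:
  assumes "S \<subseteq> carrier G" "g \<in> set_pow G S m" "h \<in> set_pow G S n"
  shows "g \<otimes> h \<in> set_pow G S (m + n)"
proof -
  obtain xs ys where
    "g = foldr (\<otimes>) xs \<one>" "length xs = m" "set xs \<subseteq> S"
    "h = foldr (\<otimes>) ys \<one>" "length ys = n" "set ys \<subseteq> S"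
    using assms(2,3) unfolding set_pow_def by auto
  moreover from this have "g \<otimes> h = foldr (\<otimes>) (xs @ ys) \<one>"
    using assms(1) foldr_mult_append[of xs ys] by auto
  ultimately show ?thesis
    unfolding set_pow_def by (intro CollectI exI[of _ "xs @ ys"]) auto
qed

text \<open>Reversing a word and inverting its letters preserves its length, and symmetry of
  \<open>S\<close> keeps the letters in \<open>S\<close>.\<close>

lemma set_pow_inv:
  assumes "S \<subseteq> carrier G" "set_inv S = S" "g \<in> set_pow G S n"
  shows "inv g \<in> set_pow G S n"
proof -
  obtain xs where xs: "g = foldr (\<otimes>) xs \<one>" "length xs = n" "set xs \<subseteq> S"
    using assms(3) unfolding set_pow_def by auto
  have "inv s \<in> S" if "s \<in> S" for s
    using that assms(2) unfolding SET_INV_def by auto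
  then have "set (rev (map (m_inv G) xs)) \<subseteq> S" using xs by auto
  with xs assms(1) show ?thesis
    unfolding set_pow_def
    by (intro CollectI exI[of _ "rev (map (m_inv G) xs)"]) (auto simp: inv_foldr_mult)
qed

lemma one_in_set_pow: "\<one> \<in> S \<Longrightarrow> \<one> \<in> set_pow G S n"
proof -
  assume "\<one> \<in> S"
  moreover have "foldr (\<otimes>) (replicate n \<one>) \<one> = \<one>" by (induction n) auto
  ultimately show ?thesis
    unfolding set_pow_def by (intro CollectI exI[of _ "replicate n \<one>"]) auto
qed

lemma set_pow_1: "S \<subseteq> carrier G \<Longrightarrow> s \<in> S \<Longrightarrow> s \<in> set_pow G S 1"
  unfolding set_pow_def by (intro CollectI exI[of _ "[s]"]) auto

end

text \<open>There are finitely many words of a given length over a finite alphabet. This makes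
  \<open>action_rel\<close> a finite union of orbit relations.\<close>

lemma finite_set_pow: "finite S \<Longrightarrow> finite (set_pow G S n)"
proof -
  assume "finite S"
  moreover have "set_pow G S n =
    (\<lambda>ss. foldr (\<lambda>s t. s \<otimes>\<^bsub>G\<^esub> t) ss \<one>\<^bsub>G\<^esub>) ` {ss. set ss \<subseteq> S \<and> length ss = n}"
    unfolding set_pow_def by auto
  ultimately show ?thesis by (simp add: finite_lists_length_eq)
qed

section \<open>Chain metrics\<close>

text \<open>\<open>P\<close> attaches the endpoints to a chain and \<open>Q\<close> joins
  consecutive links; for the action they become membership in \<open>S\<^sup>2 \<cdot> a\<close> and
  \<open>S\<^sup>4 \<cdot> a\<close>. Keeping them abstract separates the metric axioms from the
  group.\<close>

definition chain_costs ::
    "'a set \<Rightarrow> ('a \<Rightarrow> 'a \<Rightarrow> real) \<Rightarrow> 'a rel \<Rightarrow> 'a rel \<Rightarrow> 'a \<Rightarrow> 'a \<Rightarrow> real set"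
  where "chain_costs X d P Q x y =
    {real n + (\<Sum>i=1..n. d (a i) (b i)) | (n::nat) a b.
      n \<ge> 1 \<and> (\<forall>i\<in>{1..n}. a i \<in> X \<and> b i \<in> X) \<and> (x, a 1) \<in> P \<and> (y, b n) \<in> P \<and>
      (\<forall>i. 1 \<le> i \<and> i < n \<longrightarrow> (b i, a (i + 1)) \<in> Q)}"

definition chain_metric ::
    "'a set \<Rightarrow> ('a \<Rightarrow> 'a \<Rightarrow> real) \<Rightarrow> 'a rel \<Rightarrow> 'a rel \<Rightarrow> 'a \<Rightarrow> 'a \<Rightarrow> real"
  where "chain_metric X d P Q x y =
    (if x \<notin> X \<or> y \<notin> X \<or> x = y then 0 else Inf (chain_costs X d P Q x y))"

text \<open>Reflexivity of \<open>P\<close> ensures that chains exist, the two symmetries allow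
  chains to be reversed, and \<open>P O P \<subseteq> Q\<close> allows them to be
  concatenated.\<close>

locale chain_space = Metric_space X d for X :: "'a set" and d +
  fixes P Q :: "'a rel"
  assumes P_refl: "x \<in> X \<Longrightarrow> (x, x) \<in> P"
    and P_sym: "sym P" and Q_sym: "sym Q"
    and P_comp: "P O P \<subseteq> Q"
begin

abbreviation "costs \<equiv> chain_costs X d P Q"
abbreviation "D \<equiv> chain_metric X d P Q"

text \<open>The number of links alone contributes at least 1, so the infimum is over a set bounded
  below and distinct points stay apart.\<close>

lemma chain_costs_ge_1: "c \<in> costs x y \<Longrightarrow> 1 \<le> c"
proof -
  assume "c \<in> costs x y"
  then obtain n :: nat and a b where "n \<ge> 1" "c = real n + (\<Sum>i=1..n. d (a i) (b i))"
    unfolding chain_costs_def by blast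
  moreover have "0 \<le> (\<Sum>i=1..n. d (a i) (b i))" by (simp add: sum_nonneg)
  ultimately show ?thesis by linarith
qed

lemma chain_costs_single:
  assumes "a \<in> X" "b \<in> X" "(x, a) \<in> P" "(y, b) \<in> P"
  shows "1 + d a b \<in> costs x y"
  unfolding chain_costs_def mem_Collect_eq using assms
  by (intro exI[of _ "1::nat"] exI[of _ "\<lambda>_. a"] exI[of _ "\<lambda>_. b"]) auto

lemma chain_costs_reverse:
  assumes "c \<in> costs x y"
  shows "c \<in> costs y x"
proof -
  from assms obtain n :: nat and a b where
    n: "n \<ge> 1" and c: "c = real n + (\<Sum>i=1..n. d (a i) (b i))"
    and X: "\<forall>i\<in>{1..n}. a i \<in> X \<and> b i \<in> X" and P: "(x, a 1) \<in> P" "(y, b n) \<in> P"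
    and Q: "\<forall>i. 1 \<le> i \<and> i < n \<longrightarrow> (b i, a (i + 1)) \<in> Q"
    unfolding chain_costs_def by blast
  \<comment> \<open>In the reversed chain the start and end points of links swap roles, so junction
    \<open>i\<close> is the old junction \<open>n - i\<close> read backwards.\<close>
  have "(a (n + 1 - i), b (n + 1 - (i + 1))) \<in> Q" if "1 \<le> i" "i < n" for i
  proof -
    have "(b (n - i), a (n - i + 1)) \<in> Q" using Q that by simp
    moreover have "n - i + 1 = n + 1 - i" using that by simp
    ultimately show ?thesis using Q_sym by (simp add: symD)
  qed
  moreover have "(\<Sum>i=1..n. d (a i) (b i)) = (\<Sum>i=1..n. d (b (n + 1 - i)) (a (n + 1 - i)))"
    by (subst sum.atLeastAtMost_rev) (simp add: commute)
  moreover have "\<forall>i\<in>{1..n}. b (n + 1 - i) \<in> X \<and> a (n + 1 - i) \<in> X"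
  proof
    fix i assume "i \<in> {1..n}"
    then have "n + 1 - i \<in> {1..n}" by auto
    with X show "b (n + 1 - i) \<in> X \<and> a (n + 1 - i) \<in> X" by blast
  qed
  ultimately show ?thesis
    unfolding chain_costs_def mem_Collect_eq using n c P
    by (intro exI[of _ n] exI[of _ "\<lambda>i. b (n + 1 - i)"] exI[of _ "\<lambda>i. a (n + 1 - i)"]) auto
qed

text \<open>Both \<open>b n\<close> and \<open>a' 1\<close> are related by \<open>P\<close> to
  \<open>y\<close>, so \<open>P_comp\<close> supplies the missing junction in \<open>Q\<close>.
  Junctions cost nothing, hence costs add exactly.\<close>

lemma chain_costs_concat:
  assumes "c \<in> costs x y" "c' \<in> costs y z"
  shows "c + c' \<in> costs x z"
proof -
  from assms(1) obtain n :: nat and a b where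
    n: "n \<ge> 1" and c: "c = real n + (\<Sum>i=1..n. d (a i) (b i))"
    and X: "\<forall>i\<in>{1..n}. a i \<in> X \<and> b i \<in> X" and P: "(x, a 1) \<in> P" "(y, b n) \<in> P"
    and Q: "\<forall>i. 1 \<le> i \<and> i < n \<longrightarrow> (b i, a (i + 1)) \<in> Q"
    unfolding chain_costs_def by blast
  from assms(2) obtain m :: nat and a' b' where
    m: "m \<ge> 1" and c': "c' = real m + (\<Sum>i=1..m. d (a' i) (b' i))"
    and X': "\<forall>i\<in>{1..m}. a' i \<in> X \<and> b' i \<in> X" and P': "(y, a' 1) \<in> P" "(z, b' m) \<in> P"
    and Q': "\<forall>i. 1 \<le> i \<and> i < m \<longrightarrow> (b' i, a' (i + 1)) \<in> Q"
    unfolding chain_costs_def by blast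
  \<comment> \<open>The second chain is shifted by \<open>n\<close>, so that the junction between
    the chains falls at index \<open>n\<close>.\<close>
  define A where "A i = (if i \<le> n then a i else a' (i - n))" for i
  define B where "B i = (if i \<le> n then b i else b' (i - n))" for i
  have "(\<Sum>i=1..n+m. d (A i) (B i)) = (\<Sum>i=1..n. d (A i) (B i)) + (\<Sum>i=n+1..n+m. d (A i) (B i))"
    by (rule sum.ub_add_nat) simp
  also have "(\<Sum>i=n+1..n+m. d (A i) (B i)) = (\<Sum>i=1..m. d (A (i + n)) (B (i + n)))"
    using sum.shift_bounds_cl_nat_ivl[of "\<lambda>i. d (A i) (B i)" 1 n m] by (simp add: add.commute)
  also have "\<dots> = (\<Sum>i=1..m. d (a' i) (b' i))"
    by (rule sum.cong) (auto simp: A_def B_def)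
  also have "(\<Sum>i=1..n. d (A i) (B i)) = (\<Sum>i=1..n. d (a i) (b i))"
    by (rule sum.cong) (auto simp: A_def B_def)
  finally have "c + c' = real (n + m) + (\<Sum>i=1..n+m. d (A i) (B i))"
    using c c' by simp
  moreover have "(B i, A (i + 1)) \<in> Q" if "1 \<le> i" "i < n + m" for i
  proof -
    consider "i < n" | "i = n" | "n < i" by linarith
    then show ?thesis
    proof cases
      case 1
      then show ?thesis using Q that by (simp add: A_def B_def)
    next
      case 2
      have "(b n, y) \<in> P" using P P_sym by (simp add: symD)
      then have "(b n, a' 1) \<in> Q" using P' P_comp by blast
      with 2 show ?thesis by (simp add: A_def B_def)
    next
      case 3
      then have "(b' (i - n), a' (i - n + 1)) \<in> Q"
        using Q'[rule_format, of "i - n"] that by force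
      with 3 show ?thesis by (simp add: A_def B_def Suc_diff_le)
    qed
  qed
  moreover have "\<forall>i\<in>{1..n+m}. A i \<in> X \<and> B i \<in> X"
  proof
    fix i assume "i \<in> {1..n+m}"
    then have "i \<in> {1..n} \<or> \<not> i \<le> n \<and> i - n \<in> {1..m}" by auto
    with X X' show "A i \<in> X \<and> B i \<in> X" by (auto simp: A_def B_def)
  qed
  moreover have "A 1 = a 1" "B (n + m) = b' m"
    using n m by (auto simp: A_def B_def)
  ultimately show ?thesis
    unfolding chain_costs_def mem_Collect_eq using n P P'
    by (intro exI[of _ "n + m"] exI[of _ A] exI[of _ B]) auto
qed

text \<open>The single link from \<open>x\<close> to \<open>y\<close> is always a chain, so
  \<open>Inf\<close> is never applied to the empty set.\<close>

lemma chain_costs_nonempty: "x \<in> X \<Longrightarrow> y \<in> X \<Longrightarrow> costs x y \<noteq> {}"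
  using chain_costs_single[of x y x y] P_refl by auto

section \<open>Metric axioms for the chain metric\<close>

lemma chain_metric_le_cost: "c \<in> costs x y \<Longrightarrow> D x y \<le> c"
proof -
  assume c: "c \<in> costs x y"
  have "bdd_below (costs x y)" by (rule bdd_belowI) (rule chain_costs_ge_1)
  with c show ?thesis
    \<comment> \<open>The lower bound on costs covers the cases in which \<open>D x y\<close> has
      the default value 0.\<close>
    using chain_costs_ge_1[OF c] cInf_lower[OF c] by (auto simp: chain_metric_def)
qed

text \<open>Distinctness matters: \<open>D x x\<close> is 0 by definition, while every cost is at
  least 1.\<close>

lemma chain_metric_less_imp_cost:
  assumes "D x y < C" "x \<in> X" "y \<in> X" "x \<noteq> y"
  obtains c where "c \<in> costs x y" "c < C"
  using assms chain_costs_nonempty cInf_lessD[of "costs x y" C]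
  by (auto simp: chain_metric_def)

lemma chain_metric_ge_1: "x \<in> X \<Longrightarrow> y \<in> X \<Longrightarrow> x \<noteq> y \<Longrightarrow> 1 \<le> D x y"
  using chain_costs_nonempty chain_costs_ge_1 by (auto simp: chain_metric_def intro: cInf_greatest)

lemma chain_metric_commute: "D x y = D y x"
proof -
  have "costs x y = costs y x" using chain_costs_reverse by blast
  then show ?thesis by (auto simp: chain_metric_def)
qed

lemma chain_metric_triangle:
  assumes "x \<in> X" "y \<in> X" "z \<in> X"
  shows "D x z \<le> D x y + D y z"
\<comment> \<open>When one of the two distances is a default 0, there need be no chain of nearly
  that cost; the inequality is then trivial.\<close>
proof (cases "x = y \<or> y = z")
  case True
  then show ?thesis by (auto simp: chain_metric_def)
next
  case False
  show ?thesis
  \<comment> \<open>The infima need not be attained, so chains within \<open>e / 2\<close> of them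
    are concatenated.\<close>
  proof (rule field_le_epsilon)
    fix e :: real assume "0 < e"
    then have "D x y < D x y + e / 2" "D y z < D y z + e / 2" by auto
    then obtain c c' where "c \<in> costs x y" "c < D x y + e / 2" "c' \<in> costs y z" "c' < D y z + e / 2"
      using False assms chain_metric_less_imp_cost by metis
    then show "D x z \<le> D x y + D y z + e"
      using chain_metric_le_cost[OF chain_costs_concat[of c x y c' z]] by simp
  qed
qed

lemma Metric_space_chain_metric: "Metric_space X D"
proof
  show "0 \<le> D x y" for x y
    using chain_metric_ge_1[of x y] by (cases "x \<in> X \<and> y \<in> X \<and> x \<noteq> y") (auto simp: chain_metric_def)
  show "D x y = D y x" for x y by (rule chain_metric_commute)
  show "D x y = 0 \<longleftrightarrow> x = y" if "x \<in> X" "y \<in> X" for x y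
    using chain_metric_ge_1[OF that] by (cases "x = y") (simp_all add: chain_metric_def)
  show "D x z \<le> D x y + D y z" if "x \<in> X" "y \<in> X" "z \<in> X" for x y z
    using that by (rule chain_metric_triangle)
qed

text \<open>A cost of at most \<open>N\<close> bounds both the number of links and the length of
  each link by \<open>N\<close>. A chain is then a path in \<open>W\<close> with \<open>n\<close>
  links, \<open>n - 1\<close> junctions and two end steps, hence \<open>2 * n + 1\<close>
  steps.\<close>

lemma chain_costs_relpow:
  assumes "c \<in> costs x y" "c \<le> real N"
    and W: "P \<subseteq> W" "Q \<subseteq> W" "{(a, b). a \<in> X \<and> b \<in> X \<and> d a b \<le> real N} \<subseteq> W"
  obtains n where "n \<le> N" "(x, y) \<in> W ^^ (2 * n + 1)"
proof -
  from assms(1) obtain n :: nat and a b where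
    n: "n \<ge> 1" and c: "c = real n + (\<Sum>i=1..n. d (a i) (b i))"
    and X: "\<forall>i\<in>{1..n}. a i \<in> X \<and> b i \<in> X" and P: "(x, a 1) \<in> P" "(y, b n) \<in> P"
    and Q: "\<forall>i. 1 \<le> i \<and> i < n \<longrightarrow> (b i, a (i + 1)) \<in> Q"
    unfolding chain_costs_def by blast
  have ab: "(a i, b i) \<in> W" if "i \<in> {1..n}" for i
  proof -
    have "d (a i) (b i) \<le> (\<Sum>i=1..n. d (a i) (b i))"
      by (rule member_le_sum[OF that]) auto
    also have "\<dots> \<le> real N" using c assms(2) by simp
    finally show ?thesis using W(3) X that by auto
  qed
  \<comment> \<open>Each link is preceded by one step, the first by a step in \<open>P\<close> and
    every later one by a junction in \<open>Q\<close>, which gives two steps per link.\<close>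
  have path: "k < n \<Longrightarrow> (x, b (Suc k)) \<in> W ^^ (2 * Suc k)" for k
  proof (induction k)
    case 0
    then show ?case using P(1) W(1) ab[of 1] n by (auto simp: numeral_2_eq_2)
  next
    case (Suc k)
    then have "(b (Suc k), a (Suc (Suc k))) \<in> W" "(a (Suc (Suc k)), b (Suc (Suc k))) \<in> W"
      using Q[rule_format, of "Suc k"] W(2) ab[of "Suc (Suc k)"] by auto
    with Suc have "(x, b (Suc (Suc k))) \<in> W ^^ Suc (Suc (2 * Suc k))"
      by (meson Suc_lessD relpow_Suc_I)
    then show ?case by simp
  qed
  have "(b n, y) \<in> W" using P(2) P_sym W(1) by (auto dest: symD)
  with path[of "n - 1"] n have "(x, y) \<in> W ^^ (2 * n + 1)" by auto
  moreover have "n \<le> N"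
  proof -
    have "0 \<le> (\<Sum>i=1..n. d (a i) (b i))" by (simp add: sum_nonneg)
    then show ?thesis using c assms(2) by linarith
  qed
  ultimately show ?thesis using that by blast
qed

end

section \<open>Large scale structures and controlled relations\<close>

text \<open>Needed so that minimality of the hull can be applied to the structure of the chain
  metric.\<close>

lemma large_scale_structure_metric:
  assumes "Metric_space X d"
  shows "large_scale_structure X (metric_large_scale_structure X d)"
proof -
  interpret Metric_space X d by fact
  have "{} \<in> metric_large_scale_structure X d"
    by (auto simp: metric_large_scale_structure_iff)
  moreover have "\<B> \<subseteq> Pow X" if "\<B> \<in> metric_large_scale_structure X d" for \<B>
    using that by (simp add: metric_large_scale_structure_iff)
  moreover have "\<B>\<^sub>2 \<in> metric_large_scale_structure X d"
    if "\<B>\<^sub>1 \<in> metric_large_scale_structure X d" "\<B>\<^sub>2 \<subseteq> Pow X"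
      and sub: "\<forall>B\<in>\<B>\<^sub>2. (\<exists>x\<in>B. \<exists>y\<in>B. x \<noteq> y) \<longrightarrow> (\<exists>A\<in>\<B>\<^sub>1. B \<subseteq> A)" for \<B>\<^sub>1 \<B>\<^sub>2
  proof -
    obtain C where C: "C \<ge> 0" "\<forall>U\<in>\<B>\<^sub>1. \<forall>x\<in>U. \<forall>y\<in>U. d x y \<le> C"
      using \<open>\<B>\<^sub>1 \<in> _\<close> by (auto simp: metric_large_scale_structure_iff)
    have "d x y \<le> C" if "B \<in> \<B>\<^sub>2" "x \<in> B" "y \<in> B" for B x y
    \<comment> \<open>A set with at most one point need not lie in any member of
      \<open>\<B>\<^sub>1\<close>, so equal points are treated apart.\<close>
    proof (cases "x = y")
      case True
      then have "d x y = 0" using that \<open>\<B>\<^sub>2 \<subseteq> Pow X\<close> zero by blast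
      then show ?thesis using C by simp
    next
      case False
      with that sub obtain A where "A \<in> \<B>\<^sub>1" "B \<subseteq> A" by blast
      then show ?thesis using C that by blast
    qed
    with C \<open>\<B>\<^sub>2 \<subseteq> Pow X\<close> show ?thesis unfolding metric_large_scale_structure_iff by blast
  qed
  moreover have "star_family \<B>\<^sub>1 \<B>\<^sub>2 \<in> metric_large_scale_structure X d"
    if \<B>: "\<B>\<^sub>1 \<in> metric_large_scale_structure X d" "\<B>\<^sub>2 \<in> metric_large_scale_structure X d" for \<B>\<^sub>1 \<B>\<^sub>2
  proof -
    obtain C1 where C1: "C1 \<ge> 0" "\<forall>U\<in>\<B>\<^sub>1. \<forall>x\<in>U. \<forall>y\<in>U. d x y \<le> C1"
      using \<B>(1) by (auto simp: metric_large_scale_structure_iff)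
    obtain C2 where C2: "C2 \<ge> 0" "\<forall>U\<in>\<B>\<^sub>2. \<forall>x\<in>U. \<forall>y\<in>U. d x y \<le> C2"
      using \<B>(2) by (auto simp: metric_large_scale_structure_iff)
    have sub: "\<B>\<^sub>1 \<subseteq> Pow X" "\<B>\<^sub>2 \<subseteq> Pow X"
      using \<B> by (simp_all add: metric_large_scale_structure_iff)
    \<comment> \<open>The path goes from \<open>x\<close> to \<open>B\<close> inside one member of
      \<open>\<B>\<^sub>2\<close>, across \<open>B\<close>, and on to \<open>y\<close> inside
      another member.\<close>
    have "d x y \<le> C2 + C1 + C2" if "B \<in> \<B>\<^sub>1" "x \<in> star B \<B>\<^sub>2" "y \<in> star B \<B>\<^sub>2" for B x y
    proof -
      obtain U V p q where UV: "U \<in> \<B>\<^sub>2" "x \<in> U" "p \<in> U" "p \<in> B" "V \<in> \<B>\<^sub>2" "y \<in> V" "q \<in> V" "q \<in> B"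
        using \<open>x \<in> star B \<B>\<^sub>2\<close> \<open>y \<in> star B \<B>\<^sub>2\<close> unfolding star_def by blast
      then have "x \<in> X" "y \<in> X" "p \<in> X" "q \<in> X" using sub by auto
      then have "d x y \<le> d x p + d p q + d q y"
        using triangle[of x p y] triangle[of p q y] by linarith
      moreover have "d x p \<le> C2" "d p q \<le> C1" "d q y \<le> C2" using UV C1 C2 that by blast+
      ultimately show ?thesis by linarith
    qed
    moreover have "star_family \<B>\<^sub>1 \<B>\<^sub>2 \<subseteq> Pow X"
      using sub unfolding star_family_def star_def by blast
    ultimately show ?thesis
      unfolding metric_large_scale_structure_iff star_family_def using C1 C2
      by (intro conjI exI[of _ "C2 + C1 + C2"]) auto
  qed
  ultimately show ?thesis
    unfolding large_scale_structure_def by (intro conjI ballI allI impI) (rule notI, simp)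
qed

section \<open>Closure rules for large scale structures\<close>

lemma large_scale_structure_refine:
  assumes "large_scale_structure X L" "\<B>\<^sub>1 \<in> L" "\<B>\<^sub>2 \<subseteq> Pow X"
    "\<And>B x y. B \<in> \<B>\<^sub>2 \<Longrightarrow> x \<in> B \<Longrightarrow> y \<in> B \<Longrightarrow> x \<noteq> y \<Longrightarrow> \<exists>A\<in>\<B>\<^sub>1. B \<subseteq> A"
  shows "\<B>\<^sub>2 \<in> L"
proof -
  have "\<forall>\<B>\<^sub>1\<in>L. \<forall>\<B>\<^sub>2. \<B>\<^sub>2 \<subseteq> Pow X \<longrightarrow>
        (\<forall>B\<in>\<B>\<^sub>2. (\<exists>x\<in>B. \<exists>y\<in>B. x \<noteq> y) \<longrightarrow> (\<exists>A\<in>\<B>\<^sub>1. B \<subseteq> A)) \<longrightarrow> \<B>\<^sub>2 \<in> L"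
    using assms(1) unfolding large_scale_structure_def by (elim conjE)
  from this[THEN bspec, OF assms(2), THEN spec, THEN mp, OF assms(3)]
  show ?thesis using assms(4) by blast
qed

lemma large_scale_structure_star:
  assumes "large_scale_structure X L" "\<B>\<^sub>1 \<in> L" "\<B>\<^sub>2 \<in> L"
  shows "star_family \<B>\<^sub>1 \<B>\<^sub>2 \<in> L"
proof -
  have "\<forall>\<B>\<^sub>1\<in>L. \<forall>\<B>\<^sub>2\<in>L. star_family \<B>\<^sub>1 \<B>\<^sub>2 \<in> L"
    using assms(1) unfolding large_scale_structure_def by (elim conjE)
  with assms(2,3) show ?thesis by blast
qed

lemma large_scale_structure_subset:
  assumes "large_scale_structure X L" "\<B> \<in> L"
  shows "\<B> \<subseteq> Pow X"
proof -
  have "\<forall>\<B>\<in>L. \<B> \<subseteq> Pow X"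
    using assms(1) unfolding large_scale_structure_def by (elim conjE)
  with assms(2) show ?thesis by blast
qed

text \<open>A relation \<open>E\<close> is controlled by \<open>L\<close> when
  \<open>edge_family E \<in> L\<close>; in this form boundedness can be handled by composing
  relations.\<close>

definition edge_family :: "'a rel \<Rightarrow> 'a set set"
  where "edge_family E = {{x, y} | x y. (x, y) \<in> E}"

text \<open>The diagonal adds only singletons, and refinement constrains only sets with more than
  one point.\<close>

lemma edge_family_reflcl:
  assumes "large_scale_structure X L" "edge_family E \<in> L"
  shows "edge_family (E \<union> Id_on X) \<in> L"
proof (rule large_scale_structure_refine[OF assms])
  have "edge_family E \<subseteq> Pow X"
    using assms by (rule large_scale_structure_subset)
  then show "edge_family (E \<union> Id_on X) \<subseteq> Pow X"
    unfolding edge_family_def by blast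
qed (auto simp: edge_family_def)

lemma edge_family_mono:
  assumes "large_scale_structure X L" "edge_family E \<in> L" "F \<subseteq> E"
  shows "edge_family F \<in> L"
proof (rule large_scale_structure_refine[OF assms(1,2)])
  have "edge_family E \<subseteq> Pow X"
    using assms(1,2) by (rule large_scale_structure_subset)
  then show "edge_family F \<subseteq> Pow X"
    using assms(3) unfolding edge_family_def by blast
qed (use assms(3) in \<open>auto simp: edge_family_def\<close>)

lemma edge_family_field:
  assumes "large_scale_structure X L" "edge_family E \<in> L" "(x, y) \<in> E"
  shows "x \<in> X" "y \<in> X"
proof -
  have "edge_family E \<subseteq> Pow X"
    using assms(1,2) by (rule large_scale_structure_subset)
  then show "x \<in> X" "y \<in> X"
    using assms(3) unfolding edge_family_def by blast+
qed

text \<open>For \<open>(x, y) \<in> E\<close> and \<open>(y, z) \<in> F\<close>, the star of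
  \<open>{x, y}\<close> contains \<open>z\<close> through the edge \<open>{y, z}\<close>. The
  diagonal is added to \<open>F\<close> so that the star also contains \<open>x\<close>.\<close>

lemma edge_family_relcomp:
  assumes L: "large_scale_structure X L" and E: "edge_family E \<in> L" and F: "edge_family F \<in> L"
  shows "edge_family (E O F) \<in> L"
proof (rule large_scale_structure_refine[OF L])
  show "star_family (edge_family E) (edge_family (F \<union> Id_on X)) \<in> L"
    by (intro large_scale_structure_star[OF L] edge_family_reflcl[OF L] E F)
  show "edge_family (E O F) \<subseteq> Pow X"
    using edge_family_field[OF L E] edge_family_field[OF L F]
    unfolding edge_family_def by blast
next
  fix B assume "B \<in> edge_family (E O F)"
  then obtain x y z where B: "B = {x, z}" "(x, y) \<in> E" "(y, z) \<in> F"
    unfolding edge_family_def by blast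
  have x: "x \<in> X" using edge_family_field[OF L E] B by blast
  have 1: "{x, y} \<in> edge_family E" and 2: "{x} \<in> edge_family (F \<union> Id_on X)"
    and 3: "{y, z} \<in> edge_family (F \<union> Id_on X)"
    using B x unfolding edge_family_def by blast+
  from 2 3 have "B \<subseteq> star {x, y} (edge_family (F \<union> Id_on X))"
    unfolding star_def B(1) by blast
  with 1 show "\<exists>A\<in>star_family (edge_family E) (edge_family (F \<union> Id_on X)). B \<subseteq> A"
    unfolding star_family_def by blast
qed

text \<open>Both relations embed in the composition of their reflexive closures, which reduces
  unions to compositions.\<close>

lemma edge_family_Un:
  assumes L: "large_scale_structure X L" and E: "edge_family E \<in> L" and F: "edge_family F \<in> L"
  shows "edge_family (E \<union> F) \<in> L"
proof (rule edge_family_mono[OF L])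
  show "edge_family ((E \<union> Id_on X) O (F \<union> Id_on X)) \<in> L"
    by (intro edge_family_relcomp[OF L] edge_family_reflcl[OF L] E F)
  show "E \<union> F \<subseteq> (E \<union> Id_on X) O (F \<union> Id_on X)"
    using edge_family_field[OF L E] edge_family_field[OF L F] by fastforce
qed

lemma edge_family_empty:
  assumes "large_scale_structure X L"
  shows "edge_family {} \<in> L"
proof -
  obtain \<B> where "\<B> \<in> L" using assms unfolding large_scale_structure_def by (elim conjE) blast
  then show ?thesis
    by (rule large_scale_structure_refine[OF assms]) (auto simp: edge_family_def)
qed

lemma edge_family_UN:
  assumes L: "large_scale_structure X L" and "finite I" "\<And>i. i \<in> I \<Longrightarrow> edge_family (E i) \<in> L"
  shows "edge_family (\<Union>i\<in>I. E i) \<in> L"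
  using assms(2,3)
proof (induction I)
  case empty
  then show ?case using edge_family_empty[OF L] by simp
next
  case (insert i I)
  then show ?case using edge_family_Un[OF L, of "E i" "\<Union>i\<in>I. E i"] by simp
qed

text \<open>Only positive powers occur, since \<open>E ^^ 0\<close> is the identity on the whole
  type and may leave \<open>X\<close>.\<close>

lemma edge_family_relpow:
  assumes L: "large_scale_structure X L" and E: "edge_family E \<in> L"
  shows "edge_family (E ^^ Suc n) \<in> L"
proof (induction n)
  case (Suc n)
  then show ?case using edge_family_relcomp[OF L _ E] by (metis relpow.simps(2))
qed (simp add: E)

text \<open>Each member of the family lies in the star of any one of its points.\<close>

lemma large_scale_structure_edges:
  assumes L: "large_scale_structure X L" and E: "edge_family E \<in> L" and "\<U> \<subseteq> Pow X"
    and UE: "\<And>U x y. U \<in> \<U> \<Longrightarrow> x \<in> U \<Longrightarrow> y \<in> U \<Longrightarrow> (x, y) \<in> E"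
  shows "\<U> \<in> L"
proof (rule large_scale_structure_refine[OF L])
  have "edge_family (Id_on X) \<in> L"
    using edge_family_reflcl[OF L edge_family_empty[OF L]] by simp
  then show "star_family (edge_family (Id_on X)) (edge_family E) \<in> L"
    by (intro large_scale_structure_star[OF L] E)
  show "\<U> \<subseteq> Pow X" by fact
next
  fix U x assume U: "U \<in> \<U>" "x \<in> U"
  have "U \<subseteq> star {x} (edge_family E)"
  proof
    fix y assume "y \<in> U"
    with U UE have "{x, y} \<in> edge_family E" unfolding edge_family_def by blast
    then show "y \<in> star {x} (edge_family E)" unfolding star_def by blast
  qed
  moreover have "{x} \<in> edge_family (Id_on X)"
    using U \<open>\<U> \<subseteq> Pow X\<close> unfolding edge_family_def by blast
  ultimately show "\<exists>A\<in>star_family (edge_family (Id_on X)) (edge_family E). U \<subseteq> A"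
    unfolding star_family_def by blast
qed

section \<open>The chain metric of an action\<close>

definition action_rel ::
    "('g, 'm) monoid_scheme \<Rightarrow> 'a set \<Rightarrow> ('g \<Rightarrow> 'a \<Rightarrow> 'a) \<Rightarrow> 'g set \<Rightarrow> nat \<Rightarrow> 'a rel"
  where "action_rel G X \<phi> S k = {(\<phi> g x, x) | g x. g \<in> set_pow G S k \<and> x \<in> X}"

lemma action_metric_eq_chain_metric:
  "action_metric G X d \<phi> S = chain_metric X d (action_rel G X \<phi> S 2) (action_rel G X \<phi> S 4)"
proof (intro ext)
  fix x y
  have rel: "p \<in> (\<lambda>g. \<phi> g q) ` set_pow G S k \<longleftrightarrow> (p, q) \<in> action_rel G X \<phi> S k"
    if "q \<in> X" for p q k
    using that unfolding action_rel_def by auto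
  have "n \<ge> 1 \<and> (\<forall>i\<in>{1..n}. a i \<in> X \<and> b i \<in> X) \<and>
        x \<in> (\<lambda>g. \<phi> g (a 1)) ` set_pow G S 2 \<and> y \<in> (\<lambda>g. \<phi> g (b n)) ` set_pow G S 2 \<and>
        (\<forall>i. 1 \<le> i \<and> i < n \<longrightarrow> b i \<in> (\<lambda>g. \<phi> g (a (i + 1))) ` set_pow G S 4) \<longleftrightarrow>
      n \<ge> 1 \<and> (\<forall>i\<in>{1..n}. a i \<in> X \<and> b i \<in> X) \<and>
        (x, a 1) \<in> action_rel G X \<phi> S 2 \<and> (y, b n) \<in> action_rel G X \<phi> S 2 \<and>
        (\<forall>i. 1 \<le> i \<and> i < n \<longrightarrow> (b i, a (i + 1)) \<in> action_rel G X \<phi> S 4)"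
    for n :: nat and a b
  \<comment> \<open>The translation \<open>rel\<close> applies only to base points in
    \<open>X\<close>, which the first two conjuncts guarantee.\<close>
  proof (cases "n \<ge> 1 \<and> (\<forall>i\<in>{1..n}. a i \<in> X \<and> b i \<in> X)")
    case True
    then have "a 1 \<in> X" "b n \<in> X" "\<And>i. 1 \<le> i \<and> i < n \<Longrightarrow> a (i + 1) \<in> X" by auto
    with True show ?thesis by (simp add: rel cong: imp_cong)
  qed blast
  then show "action_metric G X d \<phi> S x y =
      chain_metric X d (action_rel G X \<phi> S 2) (action_rel G X \<phi> S 4) x y"
    unfolding action_metric_def chain_metric_def chain_costs_def by presburger
qed

context group_action
begin

lemma sym_action_rel:
  assumes "S \<subseteq> carrier G" "set_inv\<^bsub>G\<^esub> S = S"
  shows "sym (action_rel G E \<phi> S k)"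
proof (rule symI)
  interpret group G by (rule group_hom.axioms(1)[OF group_hom])
  fix y x assume "(y, x) \<in> action_rel G E \<phi> S k"
  then obtain g where g: "g \<in> set_pow G S k" "x \<in> E" "y = \<phi> g x"
    unfolding action_rel_def by blast
  have gG: "g \<in> carrier G" using set_pow_closed assms(1) g(1) by blast
  then have "x = \<phi> (inv\<^bsub>G\<^esub> g) y" "y \<in> E"
    using orbit_sym_aux[OF gG g(2)] g element_image by auto
  moreover have "inv\<^bsub>G\<^esub> g \<in> set_pow G S k" by (rule set_pow_inv[OF assms g(1)])
  ultimately show "(x, y) \<in> action_rel G E \<phi> S k" unfolding action_rel_def by blast
qed

lemma action_rel_relcomp:
  assumes "S \<subseteq> carrier G"
  shows "action_rel G E \<phi> S m O action_rel G E \<phi> S n \<subseteq> action_rel G E \<phi> S (m + n)"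
proof clarify
  interpret group G by (rule group_hom.axioms(1)[OF group_hom])
  fix x y z assume "(x, y) \<in> action_rel G E \<phi> S m" "(y, z) \<in> action_rel G E \<phi> S n"
  then obtain g h where "g \<in> set_pow G S m" "h \<in> set_pow G S n" "z \<in> E" "x = \<phi> g (\<phi> h z)"
    unfolding action_rel_def by blast
  moreover from this have "x = \<phi> (g \<otimes>\<^bsub>G\<^esub> h) z"
    using composition_rule set_pow_closed assms by metis
  ultimately show "(x, z) \<in> action_rel G E \<phi> S (m + n)"
    using set_pow_mult[OF assms] unfolding action_rel_def by blast
qed

text \<open>Each element of \<open>set_pow G S k\<close> contributes one of the orbit families
  assumed to lie in \<open>L\<close>, and there are finitely many such elements.\<close>

lemma edge_family_action_rel:
  assumes L: "large_scale_structure E L" and S: "finite S" "S \<subseteq> carrier G"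
    and orbits: "\<And>g. g \<in> carrier G \<Longrightarrow> {{x, \<phi> g x} | x. x \<in> E} \<in> L"
  shows "edge_family (action_rel G E \<phi> S k) \<in> L"
proof -
  interpret group G by (rule group_hom.axioms(1)[OF group_hom])
  have "edge_family {(\<phi> g x, x) | x. x \<in> E} = {{x, \<phi> g x} | x. x \<in> E}" for g
    unfolding edge_family_def by blast
  then have "edge_family (\<Union>g\<in>set_pow G S k. {(\<phi> g x, x) | x. x \<in> E}) \<in> L"
    using orbits S set_pow_closed finite_set_pow by (intro edge_family_UN[OF L]) auto
  moreover have "(\<Union>g\<in>set_pow G S k. {(\<phi> g x, x) | x. x \<in> E}) = action_rel G E \<phi> S k"
    unfolding action_rel_def by blast
  ultimately show ?thesis by simp
qed

end

theorem corollary7p2: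
  fixes X :: "'a set" and d :: "'a \<Rightarrow> 'a \<Rightarrow> real"
    and G :: "('g, 'm) monoid_scheme" and \<phi> :: "'g \<Rightarrow> 'a \<Rightarrow> 'a" and S :: "'g set"
  assumes "Metric_space X d"
    and "group G"
    and "coarse_action G X d \<phi>"
    and "finite S" and "S \<subseteq> carrier G" and "set_inv\<^bsub>G\<^esub> S = S" and "\<one>\<^bsub>G\<^esub> \<in> S"
    and "generate G S = carrier G"
  shows "Metric_space X (action_metric G X d \<phi> S) \<and>
    action_large_scale_structure G X d \<phi> =
      metric_large_scale_structure X (action_metric G X d \<phi> S)"
proof -
  note S = assms(4-8)
  define P where "P = action_rel G X \<phi> S 2"
  define Q where "Q = action_rel G X \<phi> S 4"
  interpret group G by fact
  interpret act: group_action G X \<phi> using assms(3) unfolding coarse_action_def by blast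
  have \<phi>_one: "\<phi> \<one>\<^bsub>G\<^esub> x = x" if "x \<in> X" for x
    using that act.id_eq_one by (metis restrict_apply')
  interpret chain_space X d P Q
  proof (intro chain_space.intro chain_space_axioms.intro)
    show "(x, x) \<in> P" if "x \<in> X" for x
      using that \<phi>_one[OF that] one_in_set_pow[OF S(4), of 2]
      unfolding P_def action_rel_def by force
    show "sym P" "sym Q" unfolding P_def Q_def by (rule act.sym_action_rel[OF S(2,3)])+
    show "P O P \<subseteq> Q" using act.action_rel_relcomp[OF S(2), of 2 2] unfolding P_def Q_def by simp
  qed (rule assms(1))
  have D: "action_metric G X d \<phi> S = D"
    unfolding P_def Q_def by (rule action_metric_eq_chain_metric)
  note metric = Metric_space_chain_metric
  let ?F = "metric_large_scale_structure X d \<union> {{{x, \<phi> g x} | x. x \<in> X} | g. g \<in> carrier G}"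
  \<comment> \<open>A single stationary link at \<open>x\<close> costs \<open>1 + d x x = 1\<close>.
    It reaches \<open>\<phi> s x\<close> because \<open>s\<close> is the word
    \<open>s \<otimes> \<one>\<close> of length 2.\<close>
  have step: "D x (\<phi> s x) \<le> 1" if "s \<in> S" "x \<in> X" for s x
  proof -
    have "s \<otimes>\<^bsub>G\<^esub> \<one>\<^bsub>G\<^esub> \<in> set_pow G S (1 + 1)"
      by (intro set_pow_mult set_pow_1 S that)
    then have "s \<in> set_pow G S 2"
      using that S(2) by (simp add: numeral_2_eq_2 subset_iff)
    then have "(\<phi> s x, x) \<in> P" using that unfolding P_def action_rel_def by blast
    then show ?thesis
      using chain_metric_le_cost[OF chain_costs_single[OF that(2,2) P_refl[OF that(2)]]] that by simp
  qed
  \<comment> \<open>Since \<open>S\<close> generates \<open>G\<close>, the displacement bound,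
    uniform in \<open>x\<close>, extends from generators to all of \<open>G\<close> by adding bounds
    along products.\<close>
  have orbit: "\<exists>C\<ge>0. \<forall>x\<in>X. D x (\<phi> g x) \<le> C" if "g \<in> generate G S" for g
    using that
  proof induction
    case one
    then show ?case using \<phi>_one by (intro exI[of _ 0]) (simp add: chain_metric_def)
  next
    case (incl s)
    then show ?case using step by (intro exI[of _ 1]) simp
  next
    case (inv s)
    then have "inv\<^bsub>G\<^esub> s \<in> S" using S(3) unfolding SET_INV_def by blast
    then show ?case using step by (intro exI[of _ 1]) simp
  next
    case (eng g h)
    then obtain C1 C2 where C: "C1 \<ge> 0" "\<forall>x\<in>X. D x (\<phi> g x) \<le> C1" "C2 \<ge> 0" "\<forall>x\<in>X. D x (\<phi> h x) \<le> C2"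
      by blast
    have gh: "g \<in> carrier G" "h \<in> carrier G" using eng S(5) by auto
    have "D x (\<phi> (g \<otimes>\<^bsub>G\<^esub> h) x) \<le> C2 + C1" if x: "x \<in> X" for x
    proof -
      have hx: "\<phi> h x \<in> X" "\<phi> g (\<phi> h x) \<in> X" using act.element_image gh x by blast+
      have "\<phi> (g \<otimes>\<^bsub>G\<^esub> h) x = \<phi> g (\<phi> h x)" by (rule act.composition_rule[OF x gh])
      then show ?thesis
        using chain_metric_triangle[OF x hx] C(2,4) hx x by fastforce
    qed
    then show ?case using C by (intro exI[of _ "C2 + C1"]) simp
  qed
  \<comment> \<open>By minimality of the hull it suffices that both kinds of generating families are
    bounded for \<open>D\<close>.\<close>
  have "action_large_scale_structure G X d \<phi> \<subseteq> metric_large_scale_structure X D"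
    unfolding action_large_scale_structure_def
  proof (rule hull_minimal[of _ _ "large_scale_structure X"], intro Un_least subsetI)
    show "large_scale_structure X (metric_large_scale_structure X D)"
      by (rule large_scale_structure_metric[OF metric])
  next
    fix \<U> assume "\<U> \<in> metric_large_scale_structure X d"
    then obtain C where C: "\<U> \<subseteq> Pow X" "C \<ge> 0" "\<forall>U\<in>\<U>. \<forall>x\<in>U. \<forall>y\<in>U. d x y \<le> C"
      by (auto simp: metric_large_scale_structure_iff)
    have "D x y \<le> 1 + C" if "U \<in> \<U>" "x \<in> U" "y \<in> U" for U x y
    proof -
      have xy: "x \<in> X" "y \<in> X" using that C(1) by auto
      have "D x y \<le> 1 + d x y"
        by (intro chain_metric_le_cost chain_costs_single P_refl xy)
      also have "d x y \<le> C" using that C by blast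
      finally show ?thesis by simp
    qed
    with C show "\<U> \<in> metric_large_scale_structure X D"
      unfolding metric_large_scale_structure_iff by (intro conjI exI[of _ "1 + C"]) auto
  next
    fix \<U> assume "\<U> \<in> {{{x, \<phi> g x} | x. x \<in> X} | g. g \<in> carrier G}"
    then obtain g where g: "g \<in> carrier G" "\<U> = {{x, \<phi> g x} | x. x \<in> X}" by blast
    then obtain C where C: "C \<ge> 0" "\<forall>x\<in>X. D x (\<phi> g x) \<le> C" using orbit S(5) by blast
    \<comment> \<open>\<open>chain_metric_def\<close> is instantiated only on the diagonal, where it
      gives 0; the mixed pairs use the bound and symmetry.\<close>
    have "D y z \<le> C" if "x \<in> X" "y \<in> {x, \<phi> g x}" "z \<in> {x, \<phi> g x}" for x y z
      using that C chain_metric_commute[of x "\<phi> g x"]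
      by (auto simp: chain_metric_def[where x = x and y = x]
          chain_metric_def[where x = "\<phi> g x" and y = "\<phi> g x"])
    with C g act.element_image show "\<U> \<in> metric_large_scale_structure X D"
      unfolding metric_large_scale_structure_iff by blast
  qed
  \<comment> \<open>The hull is an intersection, so an arbitrary structure \<open>L\<close>
    containing the generators is considered.\<close>
  moreover have "metric_large_scale_structure X D \<subseteq> action_large_scale_structure G X d \<phi>"
    unfolding action_large_scale_structure_def hull_def
  proof (intro subsetI InterI)
    fix \<U> L
    assume \<U>: "\<U> \<in> metric_large_scale_structure X D"
      and "L \<in> {L. large_scale_structure X L \<and> ?F \<subseteq> L}"
    then have L: "large_scale_structure X L" and LF: "?F \<subseteq> L" by blast+
    obtain C where C: "\<U> \<subseteq> Pow X" "\<forall>U\<in>\<U>. \<forall>x\<in>U. \<forall>y\<in>U. D x y \<le> C"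
      using \<U> by (auto simp: metric_large_scale_structure_iff)
    \<comment> \<open>The strict inequality leaves room for a chain of cost below \<open>N\<close>,
      as the infimum may not be attained.\<close>
    obtain N :: nat where N: "C < real N" using reals_Archimedean2 by blast
    define R where "R = {(a, b). a \<in> X \<and> b \<in> X \<and> d a b \<le> real N}"
    define W where "W = P \<union> Q \<union> R"
    have "edge_family R \<in> metric_large_scale_structure X d"
      unfolding metric_large_scale_structure_iff edge_family_def R_def
      by (intro conjI exI[of _ "real N"]) (auto simp: commute)
    then have "edge_family R \<in> L" using LF by blast
    moreover have "edge_family P \<in> L" "edge_family Q \<in> L"
      unfolding P_def Q_def using LF by (intro act.edge_family_action_rel[OF L S(1,2)]; blast)+
    ultimately have W: "edge_family W \<in> L"
      unfolding W_def by (intro edge_family_Un[OF L])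
    \<comment> \<open>The number of links is only bounded by \<open>N\<close>, hence the finite
      union of powers. The diagonal is added because equal points have distance 0 by definition, not
      through a chain.\<close>
    have "edge_family ((\<Union>n\<in>{..N}. W ^^ (2 * n + 1)) \<union> Id_on X) \<in> L"
      using edge_family_relpow[OF L W]
      by (intro edge_family_reflcl[OF L] edge_family_UN[OF L]) simp_all
    then show "\<U> \<in> L"
    proof (rule large_scale_structure_edges[OF L _ C(1)])
      fix U x y assume U: "U \<in> \<U>" "x \<in> U" "y \<in> U"
      then have xy: "x \<in> X" "y \<in> X" using C(1) by auto
      show "(x, y) \<in> (\<Union>n\<in>{..N}. W ^^ (2 * n + 1)) \<union> Id_on X"
      proof (cases "x = y")
        case True
        then show ?thesis using xy by auto
      next
        case False
        have "D x y < real N" using C(2) U N by (meson le_less_trans)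
        then obtain c where c: "c \<in> costs x y" "c < real N"
          using chain_metric_less_imp_cost xy False by blast
        obtain n where "n \<le> N" "(x, y) \<in> W ^^ (2 * n + 1)"
          by (rule chain_costs_relpow[OF c(1) less_imp_le[OF c(2)], of W])
            (auto simp: W_def R_def)
        then show ?thesis by blast
      qed
    qed
  qed
  ultimately show ?thesis using metric unfolding D by blast
qed

end
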